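(* Let $a>0$, $b\in\mathbb{R}$ and $t>0$. Let $$A=A_1+\mathrm{i}A_2=1-b^2-4a-2\mathrm{i}b,\qquad c=c_1+\mathrm{i}c_2=\sqrt{A},$$ with $A_1,A_2,c_1,c_2\in\mathbb{R}$. Set $$T=\frac12\Bigl((|A|-A_1+2)\cosh (c_1t)+(|A|+A_1-2)\cos (c_2t)\Bigr)$$ and $$S=8a\bigl(1-\operatorname{Re}(\cosh (ct))\bigr)+\frac14(2-A_1)|A|\bigl(\cosh (2c_1t)-\cos (2c_2t)\bigr)+\Bigl(2a+\frac14|A|^2\Bigr)\bigl(\cosh (2c_1t)+\cos (2c_2t)-2\bigr).$$ Then $$\|\mathrm{e}^{-tM_{a,b}}\|^2=\frac{1}{|A|}\,\mathrm{e}^{-t}\bigl(T+\sqrt{S}\bigr).$$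
   Context: $$M_{a,b}=\begin{pmatrix}1&b&\sqrt a&0\\-b&1&0&\sqrt a\\-\sqrt a&0&0&0\\0&-\sqrt a&0&0\end{pmatrix}.$$ $\|\cdot\|$ is the operator norm on $4\times4$ matrices induced by the Euclidean norm on $\mathbb{C}^4$. $\sqrt A$ denotes a square root of the complex number $A$ (the expressions do not depend on the choice), while $\sqrt S$ is the nonnegative square root.
   Formalization: The formal statement adds the hypothesis that A is nonzero, excluding only a = 1/4, b = 0, where the factor 1/|A| in the formula is undefined. *)

theory Defs
  imports "HOL-Analysis.Analysis"
begin

definition M :: "real \<Rightarrow> real \<Rightarrow> complex ^ 4 ^ 4" where
  "M a b = vector
     [vector [1, of_real b, of_real (sqrt a), 0],
      vector [- of_real b, 1, 0, of_real (sqrt a)],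
      vector [- of_real (sqrt a), 0, 0, 0],
      vector [0, - of_real (sqrt a), 0, 0]]"

(* The library's exp and power operation are not usable here: multiplication on the type
   complex ^ 'n ^ 'n is componentwise, so the powers below iterate the matrix product. *)
definition mat_exp :: "complex ^ 'n ^ 'n \<Rightarrow> complex ^ 'n ^ 'n" where
  "mat_exp B = (\<Sum>k. (1 / fact k) *\<^sub>R (((**) B) ^^ k) (mat 1))"

end

theory Submission
  imports Defs
begin

text \<open>
  Pairing the coordinates as $v_1 + \i v_2$ and $v_3 + \i v_4$ turns the real $4 \times 4$ matrix
  \<open>M a b\<close> into the complex $2 \times 2$ matrix with rows $(\tau, \sqrt a)$ and $(-\sqrt a, 0)$, where
  $\tau = 1 - \i b$. In other words \<open>M a b\<close> is the image of that matrix under the embedding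
  \<open>realify\<close> of $\<complex>^{2\times 2}$ into the real $4 \times 4$ matrices. This embedding is a homomorphism of
  real algebras that commutes with exponentials (\<open>mat_exp_realify\<close>) and preserves operator norms
  (\<open>onorm_realify\<close>). The problem is therefore two-dimensional.

  There, $-t$ times the small matrix is a scalar $s = -t\tau/2$ plus a traceless matrix $K$ with
  $K^2 = \mu^2$, where $\mu = ct/2$ because $\tau^2 - 4a = A$. Hence its exponential is
  $Q = e^s(\cosh\mu + \frac{\sinh\mu}{\mu} K)$. The largest singular value of a
  $2 \times 2$ matrix depends only on its Frobenius norm and its determinant
  (\<open>onorm_sq_2x2\<close>): $\|Q\|^2 = \frac12(F + \sqrt{F^2 - 4|\det Q|^2})$. Here $|\det Q| = e^{-t}$, and
  since $K$ is traceless the mixed terms of $F$ cancel, which leaves $F = 2 e^{-t} T / |A|$.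
  The formula then follows from the identity $S = T^2 - |A|^2$.
\<close>

section \<open>Exponential of a matrix whose shift squares to a scalar\<close>

lemma mat_mult_component: "(mat z ** X) $ i $ j = z * X $ i $ j"
  for X :: "'a::comm_semiring_1 ^ 'n ^ 'm"
  by (simp add: matrix_matrix_mult_def mat_def if_distrib [of "\<lambda>c. c * _"] cong: if_cong)

lemma mult_mat_component: "(X ** mat z) $ i $ j = X $ i $ j * z"
  for X :: "'a::comm_semiring_1 ^ 'n ^ 'm"
  by (simp add: matrix_matrix_mult_def mat_def if_distrib [of "\<lambda>c. _ * c"] cong: if_cong)

lemma mat_commute: "X ** mat z = mat z ** X"
  for X :: "'a::comm_semiring_1 ^ 'n ^ 'n"
  by (simp add: vec_eq_iff mat_mult_component mult_mat_component mult.commute)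

lemma bounded_linear_mat_mult: "bounded_linear (\<lambda>z. mat z ** X)"
  for X :: "complex ^ 'n ^ 'n"
  by (rule linear_conv_bounded_linear [THEN iffD1], rule linearI)
    (simp_all add: vec_eq_iff mat_mult_component algebra_simps)

lemma mat_component: "mat z $ i $ j = (if i = j then z else 0)"
  by (simp add: mat_def)

lemma matrix_add_rdistrib: "(A + B) ** C = A ** C + B ** C"
  for A :: "'a::semiring_1 ^ 'n ^ 'm"
  by (simp add: vec_eq_iff matrix_matrix_mult_def sum.distrib distrib_right)

text \<open>
  The matrices $(1 \pm K/\mu)/2$ are complementary projections, on whose ranges $s + K$ acts as
  multiplication by $s \pm \mu$. The two coefficients come from collecting the resulting
  expression $(s + \mu)^k (1 + K/\mu)/2 + (s - \mu)^k (1 - K/\mu)/2$ by powers of $K$.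
\<close>

lemma power_scalar_plus_square_root_of_scalar:
  fixes K :: "complex ^ 'n ^ 'n"
  assumes sq: "K ** K = mat (\<mu>\<^sup>2)" and nz: "\<mu> \<noteq> 0"
  shows "(((**) (mat s + K)) ^^ k) (mat 1) =
    mat (((s + \<mu>) ^ k + (s - \<mu>) ^ k) / 2)
    + mat (((s + \<mu>) ^ k - (s - \<mu>) ^ k) / (2 * \<mu>)) ** K"
proof (induction k)
  case 0
  then show ?case by (simp add: vec_eq_iff mat_mult_component)
next
  case (Suc k)
  define p q where "p = ((s + \<mu>) ^ k + (s - \<mu>) ^ k) / 2"
    and "q = ((s + \<mu>) ^ k - (s - \<mu>) ^ k) / (2 * \<mu>)"
  have "(((**) (mat s + K)) ^^ Suc k) (mat 1) = (mat s + K) ** (mat p + mat q ** K)"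
    using Suc by (simp add: p_def q_def)
  also have "\<dots> = mat s ** mat p + mat s ** (mat q ** K) + K ** mat p + (K ** mat q) ** K"
    by (simp add: matrix_add_ldistrib matrix_add_rdistrib matrix_mul_assoc)
  also have "(K ** mat q) ** K = mat q ** mat (\<mu>\<^sup>2)"
    by (metis mat_commute matrix_mul_assoc sq)
  also have "mat s ** mat p + mat s ** (mat q ** K) + K ** mat p + mat q ** mat (\<mu>\<^sup>2)
      = mat (s * p + q * \<mu>\<^sup>2) + mat (s * q + p) ** K"
    by (simp add: vec_eq_iff mat_mult_component mult_mat_component mat_component algebra_simps)
  also have "s * p + q * \<mu>\<^sup>2 = ((s + \<mu>) ^ Suc k + (s - \<mu>) ^ Suc k) / 2"
    using nz by (simp add: p_def q_def field_simps power2_eq_square)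
  also have "s * q + p = ((s + \<mu>) ^ Suc k - (s - \<mu>) ^ Suc k) / (2 * \<mu>)"
    using nz by (simp add: p_def q_def field_simps power2_eq_square)
  finally show ?case .
qed

lemma exp_series_scalar_plus_square_root_of_scalar:
  fixes K :: "complex ^ 'n ^ 'n"
  assumes "K ** K = mat (\<mu>\<^sup>2)" and "\<mu> \<noteq> 0"
  shows "(\<lambda>k. (1 / fact k) *\<^sub>R (((**) (mat s + K)) ^^ k) (mat 1)) sums
    (mat (exp s * cosh \<mu>) + mat (exp s * sinh \<mu> / \<mu>) ** K)"
proof -
  define e where "e z k = (1 / fact k) *\<^sub>R z ^ k" for z :: complex and k
  have e: "e z sums exp z" for z
    using exp_converges [of z] by (simp add: e_def[abs_def] divide_inverse)
  have "(\<lambda>k. (e (s + \<mu>) k + e (s - \<mu>) k) / 2) sums ((exp (s + \<mu>) + exp (s - \<mu>)) / 2)"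
    and "(\<lambda>k. (e (s + \<mu>) k - e (s - \<mu>) k) / (2 * \<mu>)) sums ((exp (s + \<mu>) - exp (s - \<mu>)) / (2 * \<mu>))"
    by (intro sums_divide sums_add sums_diff e)+
  from bounded_linear.sums [OF bounded_linear_mat_mult [of "mat 1"] this(1)]
    bounded_linear.sums [OF bounded_linear_mat_mult [of K] this(2)]
  have "(\<lambda>k. mat ((e (s + \<mu>) k + e (s - \<mu>) k) / 2)
      + mat ((e (s + \<mu>) k - e (s - \<mu>) k) / (2 * \<mu>)) ** K)
    sums (mat ((exp (s + \<mu>) + exp (s - \<mu>)) / 2)
      + mat ((exp (s + \<mu>) - exp (s - \<mu>)) / (2 * \<mu>)) ** K)"
    unfolding matrix_mul_rid by (rule sums_add)
  moreover have "mat ((e (s + \<mu>) k + e (s - \<mu>) k) / 2)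
      + mat ((e (s + \<mu>) k - e (s - \<mu>) k) / (2 * \<mu>)) ** K
      = (1 / fact k) *\<^sub>R (((**) (mat s + K)) ^^ k) (mat 1)" for k
    unfolding power_scalar_plus_square_root_of_scalar [OF assms] e_def
    by (simp add: vec_eq_iff mat_mult_component mat_component
        scaleR_conv_of_real [where 'a = complex] field_simps)
  moreover have "(exp (s + \<mu>) + exp (s - \<mu>)) / 2 = exp s * cosh \<mu>"
    and "(exp (s + \<mu>) - exp (s - \<mu>)) / (2 * \<mu>) = exp s * sinh \<mu> / \<mu>"
    using exp_add [of s \<mu>] exp_add [of s "- \<mu>"]
    by (simp_all add: cosh_field_def sinh_field_def field_simps)
  ultimately show ?thesis by simp
qed

section \<open>Operator norm of a complex 2 by 2 matrix\<close>

lemma norm_vec2_sq: "(norm u)\<^sup>2 = (cmod (u $ 1))\<^sup>2 + (cmod (u $ 2))\<^sup>2" for u :: "complex ^ 2"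
  by (simp add: norm_vec_def L2_set_def sum_2)

lemma norm_vec4_sq:
  "(norm u)\<^sup>2 = (cmod (u $ 1))\<^sup>2 + (cmod (u $ 2))\<^sup>2 + (cmod (u $ 3))\<^sup>2 + (cmod (u $ 4))\<^sup>2"
  for u :: "complex ^ 4"
  by (simp add: norm_vec_def L2_set_def sum_4)

lemma onorm_sq_eqI_attained:
  fixes f :: "'a::real_normed_vector \<Rightarrow> 'b::real_normed_vector"
  assumes bl: "bounded_linear f" and le: "\<And>x. (norm (f x))\<^sup>2 \<le> l * (norm x)\<^sup>2"
    and at: "(norm (f u))\<^sup>2 = l * (norm u)\<^sup>2" and u: "u \<noteq> 0"
  shows "(onorm f)\<^sup>2 = l"
proof (rule antisym)
  have l: "0 \<le> l"
    using at u by (metis zero_le_mult_iff zero_le_power2 norm_eq_zero zero_less_power2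
        linorder_not_less)
  have "onorm f \<le> sqrt l"
  proof (rule onorm_bound)
    show "norm (f x) \<le> sqrt l * norm x" for x
      using le [of x] real_le_rsqrt by (fastforce simp: real_sqrt_mult)
  qed (use l in simp)
  then show "(onorm f)\<^sup>2 \<le> l"
    using l onorm_pos_le [OF bl] by (metis power_mono real_sqrt_pow2)
  have "l * (norm u)\<^sup>2 \<le> (onorm f * norm u)\<^sup>2"
    unfolding at [symmetric] by (intro power_mono onorm bl norm_ge_zero)
  then show "l \<le> (onorm f)\<^sup>2" using u by (simp add: power_mult_distrib)
qed

text \<open>
  The squared norm of \<open>Q *v u\<close> is a Hermitian form with matrix $Q^*Q$, whose trace is $F$ and whose
  determinant is $|\det Q|^2$. The claimed value is the larger root of its characteristic
  polynomial, that is, the maximum of the form on the unit sphere.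
\<close>

lemma onorm_sq_2x2:
  fixes Q :: "complex ^ 2 ^ 2"
  defines "F \<equiv> (cmod (Q $ 1 $ 1))\<^sup>2 + (cmod (Q $ 1 $ 2))\<^sup>2 + (cmod (Q $ 2 $ 1))\<^sup>2 + (cmod (Q $ 2 $ 2))\<^sup>2"
  shows "(onorm ((*v) Q))\<^sup>2 = (F + sqrt (F\<^sup>2 - 4 * (cmod (det Q))\<^sup>2)) / 2"
proof -
  define p r where "p = (cmod (Q $ 1 $ 1))\<^sup>2 + (cmod (Q $ 2 $ 1))\<^sup>2"
    and "r = (cmod (Q $ 1 $ 2))\<^sup>2 + (cmod (Q $ 2 $ 2))\<^sup>2"
  define q where "q = cnj (Q $ 1 $ 1) * Q $ 1 $ 2 + cnj (Q $ 2 $ 1) * Q $ 2 $ 2"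
  define l where "l = (F + sqrt (F\<^sup>2 - 4 * (cmod (det Q))\<^sup>2)) / 2"
  have F: "F = p + r" by (simp add: F_def p_def r_def)
  have quad: "(norm (Q *v u))\<^sup>2 = p * (cmod (u $ 1))\<^sup>2 + r * (cmod (u $ 2))\<^sup>2
      + 2 * Re (cnj (u $ 1) * q * u $ 2)" for u
    unfolding norm_vec2_sq p_def q_def r_def
    by (simp add: matrix_vector_mult_def sum_2 cmod_power2)
      (simp add: power2_eq_square algebra_simps)
  have det: "(cmod (det Q))\<^sup>2 = p * r - (cmod q)\<^sup>2"
    unfolding p_def q_def r_def det_2 
    by (simp add: cmod_power2) (simp add: power2_eq_square algebra_simps)
  have disc: "F\<^sup>2 - 4 * (cmod (det Q))\<^sup>2 = (p - r)\<^sup>2 + 4 * (cmod q)\<^sup>2"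
    unfolding F det by (simp add: power2_eq_square algebra_simps)
  \<comment> \<open>The larger root \<open>l\<close> dominates both diagonal entries of the form, so square roots of
    \<open>l - p\<close> and \<open>l - r\<close> may be taken.\<close>
  have root: "\<bar>p - r\<bar> \<le> sqrt ((p - r)\<^sup>2 + 4 * (cmod q)\<^sup>2)"
    by (rule real_le_rsqrt) simp
  then have lp: "p \<le> l" and lr: "r \<le> l" unfolding l_def disc by (auto simp: F)
  have "2 * l - F = sqrt ((p - r)\<^sup>2 + 4 * (cmod q)\<^sup>2)"
    unfolding l_def disc by (simp add: field_simps)
  then have "(2 * l - F)\<^sup>2 = (p - r)\<^sup>2 + 4 * (cmod q)\<^sup>2"
    by simp
  then have char: "(l - p) * (l - r) = (cmod q)\<^sup>2"
    by (simp add: F power2_eq_square algebra_simps)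
  \<comment> \<open>By the characteristic equation the modulus of \<open>q\<close> is the geometric mean of \<open>l - p\<close> and
    \<open>l - r\<close>, so the mixed term is controlled by the arithmetic-geometric mean inequality.\<close>
  have le: "(norm (Q *v u))\<^sup>2 \<le> l * (norm u)\<^sup>2" for u
  proof -
    define x y where "x = cmod (u $ 1)" and "y = cmod (u $ 2)"
    have "Re (cnj (u $ 1) * q * u $ 2) \<le> cmod (cnj (u $ 1) * q * u $ 2)"
      by (rule complex_Re_le_cmod)
    also have "\<dots> = (sqrt (l - p) * x) * (sqrt (l - r) * y)"
    proof -
      have "cmod q = sqrt (l - p) * sqrt (l - r)"
        by (simp add: char flip: real_sqrt_mult)
      then show ?thesis by (simp add: norm_mult x_def y_def)
    qed
    finally have "2 * Re (cnj (u $ 1) * q * u $ 2) \<le> (sqrt (l - p) * x)\<^sup>2 + (sqrt (l - r) * y)\<^sup>2"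
      using sum_squares_bound [of "sqrt (l - p) * x" "sqrt (l - r) * y"] by simp
    also have "\<dots> = (l - p) * x\<^sup>2 + (l - r) * y\<^sup>2"
      using lp lr by (simp add: power_mult_distrib)
    finally show ?thesis
      unfolding quad unfolding norm_vec2_sq x_def y_def by (simp add: algebra_simps)
  qed
  have "\<exists>u. u \<noteq> 0 \<and> (norm (Q *v u))\<^sup>2 = l * (norm u)\<^sup>2"
  proof (cases "q = 0 \<and> l = p")
    case True
    then have "(norm (Q *v vector [1, 0]))\<^sup>2 = l * (norm (vector [1, 0] :: complex ^ 2))\<^sup>2"
      unfolding quad unfolding norm_vec2_sq by simp
    moreover have "vector [1, 0] \<noteq> (0 :: complex ^ 2)" by (simp add: vec_eq_iff forall_2)
    ultimately show ?thesis by blast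
  next
    case False
    \<comment> \<open>This solves the first row of the eigenvector equation for \<open>l\<close>; it vanishes exactly in the
      case treated above, where the first unit vector is an eigenvector.\<close>
    let ?u = "vector [q, of_real (l - p)] :: complex ^ 2"
    have "(norm (Q *v ?u))\<^sup>2 - l * (norm ?u)\<^sup>2
        = (l - p) * ((cmod q)\<^sup>2 - (l - p) * (l - r))"
      unfolding quad unfolding norm_vec2_sq
      by (simp add: cmod_power2 flip: of_real_diff) (simp add: power2_eq_square algebra_simps)
    moreover have "?u \<noteq> 0" using False by (auto simp: vec_eq_iff forall_2 simp flip: of_real_diff)
    ultimately show ?thesis using char by force
  qed
  then show ?thesis
    using onorm_sq_eqI_attained [OF matrix_vector_mul_bounded_linear le] unfolding l_def by blast
qed

section \<open>Complex 2 by 2 matrices as real 4 by 4 matrices\<close>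

lemma vector_4:
  "(vector [w, x, y, z] :: 'a::zero ^ 4) $ 1 = w" "(vector [w, x, y, z] :: 'a ^ 4) $ 2 = x"
  "(vector [w, x, y, z] :: 'a ^ 4) $ 3 = y" "(vector [w, x, y, z] :: 'a ^ 4) $ 4 = z"
  unfolding vector_def by simp_all

text \<open>
  Each complex entry $r + \i m$ becomes the real block with rows $(r, -m)$ and $(m, r)$, that is,
  multiplication by it on the plane. The entries are typed as complex numbers because the result is
  to act on $\<complex>^4$.
\<close>

definition realify :: "complex ^ 2 ^ 2 \<Rightarrow> complex ^ 4 ^ 4" where
  "realify Q = (let r = (\<lambda>i j. complex_of_real (Re (Q $ i $ j)));
                    m = (\<lambda>i j. complex_of_real (Im (Q $ i $ j))) in vector
     [vector [r 1 1, - m 1 1, r 1 2, - m 1 2],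
      vector [m 1 1, r 1 1, m 1 2, r 1 2],
      vector [r 2 1, - m 2 1, r 2 2, - m 2 2],
      vector [m 2 1, r 2 1, m 2 2, r 2 2]])"

lemma realify_mult: "realify (P ** Q) = realify P ** realify Q"
  by (simp add: realify_def Let_def vec_eq_iff forall_4 vector_4 matrix_matrix_mult_def sum_2 sum_4
      algebra_simps)

lemma realify_one: "realify (mat 1) = mat 1"
  by (simp add: realify_def Let_def vec_eq_iff forall_4 vector_4 mat_def)

lemma linear_realify: "linear realify"
  by (rule linearI) (simp_all add: realify_def Let_def vec_eq_iff forall_4 vector_4
      scaleR_conv_of_real [where 'a = complex])

lemma realify_power: "realify ((((**) X) ^^ k) (mat 1)) = (((**) (realify X)) ^^ k) (mat 1)"
  by (induction k) (simp_all add: realify_one realify_mult)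

lemma mat_exp_realify:
  assumes "(\<lambda>k. (1 / fact k) *\<^sub>R (((**) X) ^^ k) (mat 1)) sums L"
  shows "mat_exp (realify X) = realify L"
proof -
  have "bounded_linear realify"
    using linear_realify linear_conv_bounded_linear by blast
  from bounded_linear.sums [OF this assms]
  have "(\<lambda>k. (1 / fact k) *\<^sub>R (((**) (realify X)) ^^ k) (mat 1)) sums realify L"
    by (simp add: linear_scale [OF linear_realify] realify_power)
  then show ?thesis
    unfolding mat_exp_def by (rule sums_unique [symmetric])
qed

text \<open>
  On real vectors \<open>realify Q\<close> is a copy of \<open>Q\<close>, which gives one inequality (\<open>re\<close> identifies
  $\<complex>^2$ with $\<real>^4$). A complex vector $x$ is determined by the images under \<open>pr\<close> of $x$ and of its
  conjugate. Since \<open>realify Q\<close> has real entries it commutes with conjugation, so it acts on each of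
  the two images as \<open>Q\<close>; their squared norms add up to $2\|x\|^2$, which gives the other inequality.
\<close>

lemma onorm_realify: "onorm ((*v) (realify Q)) = onorm ((*v) Q)"
proof (rule antisym)
  note bl = matrix_vector_mul_bounded_linear
  define pr :: "complex ^ 4 \<Rightarrow> complex ^ 2" where
    "pr x = vector [x $ 1 + \<i> * x $ 2, x $ 3 + \<i> * x $ 4]" for x
  define cj :: "complex ^ 4 \<Rightarrow> complex ^ 4" where "cj x = (\<chi> i. cnj (x $ i))" for x
  define re :: "complex ^ 2 \<Rightarrow> complex ^ 4" where
    "re u = vector [of_real (Re (u $ 1)), of_real (Im (u $ 1)), of_real (Re (u $ 2)), of_real (Im (u $ 2))]" for u
  have norm_pr: "(norm (pr x))\<^sup>2 + (norm (pr (cj x)))\<^sup>2 = 2 * (norm x)\<^sup>2" for x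
    unfolding norm_vec2_sq norm_vec4_sq
    by (simp add: pr_def cj_def cmod_power2) (simp add: power2_eq_square algebra_simps)
  have pr: "pr (realify Q *v x) = Q *v pr x" for x
    by (simp add: pr_def realify_def Let_def vec_eq_iff forall_2 vector_4 matrix_vector_mult_def
        sum_2 sum_4 complex_eq_iff algebra_simps)
  have cj: "cj (realify Q *v x) = realify Q *v cj x" for x
    by (simp add: cj_def realify_def Let_def vec_eq_iff forall_4 vector_4 matrix_vector_mult_def sum_4)
  have norm_re: "norm (re u) = norm u" for u
  proof -
    have "(norm (re u))\<^sup>2 = (norm u)\<^sup>2"
      unfolding norm_vec2_sq norm_vec4_sq by (simp add: re_def vector_4 cmod_power2)
    then show ?thesis by simp
  qed
  have re: "realify Q *v re u = re (Q *v u)" for u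
    by (simp add: re_def realify_def Let_def vec_eq_iff forall_4 vector_4 matrix_vector_mult_def
        sum_2 sum_4 algebra_simps)
  let ?n = "onorm ((*v) Q)"
  show "onorm ((*v) (realify Q)) \<le> ?n"
  proof (rule onorm_bound)
    show "0 \<le> ?n" by (rule onorm_pos_le [OF bl])
    fix x
    have Q: "(norm (Q *v u))\<^sup>2 \<le> ?n\<^sup>2 * (norm u)\<^sup>2" for u
      using power_mono [OF onorm [OF bl] norm_ge_zero] by (simp add: power_mult_distrib)
    have "2 * (norm (realify Q *v x))\<^sup>2 = (norm (Q *v pr x))\<^sup>2 + (norm (Q *v pr (cj x)))\<^sup>2"
      by (simp flip: norm_pr add: pr cj)
    also have "\<dots> \<le> ?n\<^sup>2 * (2 * (norm x)\<^sup>2)"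
      using Q [of "pr x"] Q [of "pr (cj x)"] by (simp flip: norm_pr add: distrib_left)
    finally have "(norm (realify Q *v x))\<^sup>2 \<le> (?n * norm x)\<^sup>2"
      by (simp add: power_mult_distrib)
    then show "norm (realify Q *v x) \<le> ?n * norm x"
      by (rule power2_le_imp_le) (simp add: onorm_pos_le [OF bl])
  qed
  show "?n \<le> onorm ((*v) (realify Q))"
  proof (rule onorm_bound)
    show "0 \<le> onorm ((*v) (realify Q))" by (rule onorm_pos_le [OF bl])
    show "norm (Q *v u) \<le> onorm ((*v) (realify Q)) * norm u" for u
      using onorm [OF bl, of "realify Q" "re u"] by (simp add: re norm_re)
  qed
qed

section \<open>The norm formula\<close>

lemma cosh_sinh_complex:
  shows "(cmod (cosh (Complex x y)))\<^sup>2 = (cosh (2 * x) + cos (2 * y)) / 2"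
    and "(cmod (sinh (Complex x y)))\<^sup>2 = (cosh (2 * x) - cos (2 * y)) / 2"
    and "Re (cosh (Complex x y)) = cosh x * cos y"
proof -
  have c: "cosh (Complex x y) = Complex (cosh x * cos y) (sinh x * sin y)"
    and s: "sinh (Complex x y) = Complex (sinh x * cos y) (cosh x * sin y)"
    by (simp_all add: cosh_field_def sinh_field_def complex_eq_iff Re_exp Im_exp field_simps)
  show "Re (cosh (Complex x y)) = cosh x * cos y" by (simp add: c)
  have e: "(sin y)\<^sup>2 = 1 - (cos y)\<^sup>2" "(sinh x)\<^sup>2 = (cosh x)\<^sup>2 - 1"
    by (simp_all add: sin_squared_eq cosh_square_eq)
  show "(cmod (cosh (Complex x y)))\<^sup>2 = (cosh (2 * x) + cos (2 * y)) / 2"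
   and "(cmod (sinh (Complex x y)))\<^sup>2 = (cosh (2 * x) - cos (2 * y)) / 2"
    unfolding c s cosh_double_cosh cos_double_cos
    by (simp_all add: cmod_power2 power_mult_distrib e) (simp_all add: algebra_simps)
qed

theorem theorem1p2:
  fixes a b t A1 A2 c1 c2 T S :: real and A c :: complex
  assumes "a > 0" and "t > 0"
    and "A = 1 - (of_real b)\<^sup>2 - 4 * of_real a - 2 * \<i> * of_real b"
    and "A = of_real A1 + \<i> * of_real A2"
    and "A \<noteq> 0"
    and "c\<^sup>2 = A"
    and "c = of_real c1 + \<i> * of_real c2"
    and "T = 1/2 * ((cmod A - A1 + 2) * cosh (c1 * t) + (cmod A + A1 - 2) * cos (c2 * t))"
    and "S = 8 * a * (1 - Re (cosh (c * of_real t)))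
             + 1/4 * (2 - A1) * cmod A * (cosh (2 * c1 * t) - cos (2 * c2 * t))
             + (2 * a + 1/4 * (cmod A)\<^sup>2) * (cosh (2 * c1 * t) + cos (2 * c2 * t) - 2)"
  shows "(onorm ((*v) (mat_exp ((- t) *\<^sub>R M a b))))\<^sup>2
           = 1 / cmod A * exp (- t) * (T + sqrt S)"
proof -
  define \<tau> where "\<tau> = 1 - \<i> * of_real b"
  define s g \<mu> where "s = - of_real (t / 2) * \<tau>"
    and "g = - complex_of_real (t * sqrt a)" and "\<mu> = c * of_real (t / 2)"
  define K :: "complex ^ 2 ^ 2" where "K = vector [vector [s, g], vector [- g, - s]]"
  define C \<sigma> where "C = cosh \<mu>" and "\<sigma> = sinh \<mu> / \<mu>"
  \<comment> \<open>\<open>K\<close> is the traceless part of $-t$ times the 2 by 2 matrix, and \<open>Q\<close> is the exponential.\<close>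
  define Q where "Q = mat (exp s * C) + mat (exp s * \<sigma>) ** K"
  define x y where "x = cosh (c1 * t)" and "y = cos (c2 * t)"
  have sq_a: "complex_of_real (sqrt a) * complex_of_real (sqrt a) = of_real a"
    using assms(1) by (simp flip: of_real_mult)
  have A12: "A1 = 1 - b\<^sup>2 - 4 * a" "A2 = - 2 * b"
    using assms(3,4) by (auto simp: complex_eq_iff power2_eq_square)
  have absA: "(cmod A)\<^sup>2 = A1\<^sup>2 + A2\<^sup>2" by (simp add: assms(4) cmod_power2)
  have A0: "cmod A > 0" using assms(5) by simp
  have \<mu>0: "\<mu> \<noteq> 0" using assms(2,5,6) by (auto simp: \<mu>_def)
  \<comment> \<open>This is $t^2/4$ times the equation $\tau^2 - 4a = A = c^2$.\<close>
  have s_sq: "s\<^sup>2 - g\<^sup>2 = \<mu>\<^sup>2"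
    by (simp add: s_def g_def \<mu>_def power_mult_distrib power_divide assms(6) assms(3) \<tau>_def)
       (simp add: power2_eq_square sq_a field_simps)
  have "K ** K = mat (\<mu>\<^sup>2)"
    unfolding s_sq [symmetric]
    by (simp add: K_def vec_eq_iff forall_2 matrix_matrix_mult_def sum_2 mat_def power2_eq_square)
  from exp_series_scalar_plus_square_root_of_scalar [OF this \<mu>0, of s]
  have "mat_exp (realify (mat s + K)) = realify Q"
    unfolding Q_def C_def \<sigma>_def by (intro mat_exp_realify) simp
  moreover have "(- t) *\<^sub>R M a b = realify (mat s + K)"
    by (simp add: M_def realify_def Let_def vec_eq_iff forall_4 vector_4 K_def mat_def
        s_def g_def \<tau>_def scaleR_conv_of_real [where 'a = complex])
  ultimately have onorm_eq: "onorm ((*v) (mat_exp ((- t) *\<^sub>R M a b))) = onorm ((*v) Q)"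
    by (simp add: onorm_realify)
  have Q_entries: "Q $ 1 $ 1 = exp s * (C + \<sigma> * s)" "Q $ 1 $ 2 = exp s * (\<sigma> * g)"
      "Q $ 2 $ 1 = - (exp s * (\<sigma> * g))" "Q $ 2 $ 2 = exp s * (C - \<sigma> * s)"
    by (simp_all add: Q_def K_def mat_component mat_mult_component algebra_simps)
  have exps: "(cmod (exp s))\<^sup>2 = exp (- t)"
    by (simp add: s_def \<tau>_def power2_eq_square flip: exp_add)
  have "det Q = (exp s)\<^sup>2 * (C\<^sup>2 - \<sigma>\<^sup>2 * (s\<^sup>2 - g\<^sup>2))"
    unfolding det_2 Q_entries by (simp add: power2_eq_square algebra_simps)
  also have "C\<^sup>2 - \<sigma>\<^sup>2 * (s\<^sup>2 - g\<^sup>2) = 1"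
    unfolding s_sq using \<mu>0 by (simp add: C_def \<sigma>_def power_divide cosh_square_eq)
  finally have det_eq: "cmod (det Q) = exp (- t)"
    by (simp add: norm_power exps del: norm_exp_eq_Re)
  \<comment> \<open>The diagonal entries of \<open>Q\<close> are, up to the factor \<open>exp s\<close>, a sum and a difference of the same
    two numbers, so the parallelogram law removes their mixed terms.\<close>
  define F where "F = (cmod (Q $ 1 $ 1))\<^sup>2 + (cmod (Q $ 1 $ 2))\<^sup>2 + (cmod (Q $ 2 $ 1))\<^sup>2 + (cmod (Q $ 2 $ 2))\<^sup>2"
  have par: "(cmod (z + w))\<^sup>2 + (cmod (z - w))\<^sup>2 = 2 * (cmod z)\<^sup>2 + 2 * (cmod w)\<^sup>2" for z w
    by (simp add: cmod_power2) (simp add: power2_eq_square algebra_simps)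
  have "F = (cmod (exp s))\<^sup>2 * (((cmod (C + \<sigma> * s))\<^sup>2 + (cmod (C - \<sigma> * s))\<^sup>2) + 2 * (cmod (\<sigma> * g))\<^sup>2)"
    unfolding F_def Q_entries norm_minus_cancel norm_mult power_mult_distrib
    by (simp add: distrib_left)
  also have "\<dots> = exp (- t) * (2 * (cmod C)\<^sup>2 + 2 * ((cmod \<sigma>)\<^sup>2 * ((cmod s)\<^sup>2 + (cmod g)\<^sup>2)))"
    unfolding par exps by (simp add: norm_mult power_mult_distrib algebra_simps)
  also have "(cmod C)\<^sup>2 = (x + y) / 2" 
    using cosh_sinh_complex(1) [of "c1 * t / 2" "c2 * t / 2"]
    by (simp add: C_def \<mu>_def x_def y_def assms(7) Complex_eq algebra_simps)
  also have "(cmod \<sigma>)\<^sup>2 * ((cmod s)\<^sup>2 + (cmod g)\<^sup>2) = (2 - A1) * (x - y) / (2 * cmod A)"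
  proof -
    have sinh: "(cmod (sinh \<mu>))\<^sup>2 = (x - y) / 2"
      using cosh_sinh_complex(2) [of "c1 * t / 2" "c2 * t / 2"]
      by (simp add: \<mu>_def x_def y_def assms(7) Complex_eq algebra_simps)
    have mu: "(cmod \<mu>)\<^sup>2 = cmod A * t\<^sup>2 / 4"
      by (simp add: \<mu>_def norm_mult power_mult_distrib power_divide flip: assms(6) norm_power)
    have sg: "(cmod s)\<^sup>2 + (cmod g)\<^sup>2 = t\<^sup>2 / 4 * (2 - A1)"
      using assms(1) by (simp add: s_def g_def \<tau>_def cmod_power2 A12 power_mult_distrib power_divide field_simps)
    show ?thesis
      unfolding \<sigma>_def norm_divide power_divide sinh mu sg
      using assms(2) A0 by (simp add: field_simps)
  qed
  finally have F_eq: "F = exp (- t) * (2 * T / cmod A)"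
    using A0 by (simp add: assms(8) x_def y_def field_simps)
  have S_eq: "S = T\<^sup>2 - (cmod A)\<^sup>2"
  proof -
    have dbl: "cosh (2 * c1 * t) = 2 * x\<^sup>2 - 1" "cos (2 * c2 * t) = 2 * y\<^sup>2 - 1"
      using cosh_double_cosh [of "c1 * t"] cos_double_cos [of "c2 * t"] 
      by (simp_all add: x_def y_def mult.assoc)
    have T_eq: "T = (cmod A * (x + y) + (2 - A1) * (x - y)) / 2"
      by (simp add: assms(8) x_def y_def algebra_simps)
    have re: "Re (cosh (c * of_real t)) = x * y"
      using cosh_sinh_complex(3) [of "c1 * t" "c2 * t"]
      by (simp add: x_def y_def assms(7) Complex_eq algebra_simps)
    \<comment> \<open>In $T^2 - |A|^2$ the summand $16a$ contributes $4a(x - y)^2$, which is the sum of the terms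
      of \<open>S\<close> that carry a factor \<open>a\<close>.\<close>
    have "(2 - A1)\<^sup>2 = (cmod A)\<^sup>2 + 16 * a"
      unfolding absA A12 by (simp add: power2_eq_square algebra_simps)
    moreover have "T\<^sup>2 = ((cmod A)\<^sup>2 * (x + y)\<^sup>2 + 2 * cmod A * (2 - A1) * (x\<^sup>2 - y\<^sup>2) + (2 - A1)\<^sup>2 * (x - y)\<^sup>2) / 4"
      unfolding T_eq by (simp add: power_divide) (simp add: power2_eq_square algebra_simps)
    ultimately show ?thesis
      by (simp add: assms(9) dbl re) (simp add: power2_eq_square field_simps)
  qed
  have "F\<^sup>2 - 4 * (cmod (det Q))\<^sup>2 = (2 * exp (- t) / cmod A)\<^sup>2 * S"
    unfolding F_eq det_eq S_eq using A0 by (simp add: power2_eq_square field_simps)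
  then have sqrt_eq: "sqrt (F\<^sup>2 - 4 * (cmod (det Q))\<^sup>2) = 2 * exp (- t) / cmod A * sqrt S"
    by (simp add: real_sqrt_mult)
  show ?thesis
    unfolding onorm_eq onorm_sq_2x2 F_def [symmetric] sqrt_eq
    unfolding F_eq using A0 by (simp add: field_simps)
qed

end
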